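(* Let $n=p_1^{n_1}p_2^{n_2}p_3^{n_3}$, where $p_1,p_2,p_3$ are distinct primes and $n_1,n_2,n_3\geq 1$ are integers. Let $G(\mathbb{Z}_n)=(V,E)$ be the unit graph of $\mathbb{Z}_n$ and let $H$ be a $|V|\times|E|$ incidence matrix of $G(\mathbb{Z}_n)$. (1) If $2$ is a unit in $\mathbb{Z}_n$, then the binary code $C_2(H)$ generated by $H$ is a $\left[\frac{(n-1)\phi(n)}{2},\,n-1,\,\phi(n)-1\right]_{2}$ code over $\mathbb{F}_2$. (2) If $2$ is a non-unit in $\mathbb{Z}_n$, then for any odd prime $q$ the $q$-ary code $C_q(H)$ generated by $H$ is a $\left[\frac{n\phi(n)}{2},\,n-1,\,\phi(n)\right]_{q}$ code over $\mathbb{F}_q$.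
   Context: The unit graph $G(\mathbb{Z}_n)$ is the simple graph with vertex set $\mathbb{Z}_n$ in which two distinct vertices $x,y$ are adjacent iff $x+y$ is a unit of $\mathbb{Z}_n$. An incidence matrix of a graph has rows indexed by vertices and columns by edges, with entry $1$ if the vertex is an endpoint of the edge and $0$ otherwise. For a prime $q$, $C_q(H)$ denotes the $\mathbb{F}_q$-span of the rows of $H$ (entries read in $\mathbb{F}_q$), a subspace of $\mathbb{F}_q^{|E|}$. An $[N,k,d]_q$ code is a linear subspace of $\mathbb{F}_q^N$ of dimension $k$ whose minimum Hamming weight of nonzero vectors (equivalently, minimum distance) is $d$. $\phi$ is Euler's totient function. *)

theory Defs
  imports
    Berlekamp_Zassenhaus.Finite_Field
    Jordan_Normal_Form.VS_Connect
    "HOL-Number_Theory.Residues"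
begin

text \<open>A simple graph is a pair \<open>(V, E)\<close> whose edges are two-element subsets of \<open>V\<close>.\<close>

type_synonym 'v sgraph = "'v set \<times> 'v set set"

definition unit_graph :: "('r, 'm) ring_scheme \<Rightarrow> 'r sgraph" where
  "unit_graph R =
     (carrier R,
      {{x, y} | x y. x \<in> carrier R \<and> y \<in> carrier R \<and> x \<noteq> y \<and> x \<oplus>\<^bsub>R\<^esub> y \<in> Units R})"

text \<open>The lists \<open>vs\<close> and \<open>es\<close> are the arbitrary orders in which the vertices and edges
  label the rows and columns. The entries are integers, so that one matrix can be read
  in every field.\<close>

definition incidence_matrix :: "'v sgraph \<Rightarrow> int mat \<Rightarrow> bool" where
  "incidence_matrix G H \<longleftrightarrow>
     (\<exists>vs es. distinct vs \<and> set vs = fst G \<and> distinct es \<and> set es = snd G \<and>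
        H = mat (length vs) (length es) (\<lambda>(i, j). if vs ! i \<in> es ! j then 1 else 0))"

definition row_code :: "int mat \<Rightarrow> 'a :: field vec set" where
  "row_code H = vec_space.row_space (dim_col H) (map_mat of_int H)"

definition hamming_weight :: "'a :: zero vec \<Rightarrow> nat" where
  "hamming_weight v = card {i. i < dim_vec v \<and> v $ i \<noteq> 0}"

text \<open>\<open>linear_code C N k d\<close>: \<open>C\<close> is an \<open>[N, k, d]\<close> code over the field \<open>'a\<close>.\<close>

definition linear_code :: "'a :: field vec set \<Rightarrow> nat \<Rightarrow> nat \<Rightarrow> nat \<Rightarrow> bool" where
  "linear_code C N k d \<longleftrightarrow>
     VectorSpace.subspace class_ring C (module_vec TYPE('a) N) \<and>
     vectorspace.dim class_ring ((module_vec TYPE('a) N)\<lparr>carrier := C\<rparr>) = k \<and>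
     (\<exists>v \<in> C. v \<noteq> 0\<^sub>v N \<and> hamming_weight v = d) \<and>
     (\<forall>v \<in> C. v \<noteq> 0\<^sub>v N \<longrightarrow> d \<le> hamming_weight v)"

end

theory Submission
  imports Defs
begin

text \<open>The coordinate of \<open>\<Sum>\<^sub>v a\<^sub>v row\<^sub>v\<close> at the edge \<open>xy\<close> is
  \<open>a\<^sub>x + a\<^sub>y\<close>. In characteristic 2, and after changing the signs on one side of a bipartite
  graph, this is a difference of labels, so a codeword is supported on the edges whose ends carry different labels. It vanishes iff the labelling is
  constant on components, and otherwise its support contains an edge cut. Hence for a connected
  graph the dimension is \<open>|V| - 1\<close> by rank-nullity, and the minimum weight is the minimum
  degree as soon as every edge cut is at least that large.

  The bound on cuts is Plesnik's argument. If every vertex on one side of the cut has a neighbour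
  across, a degree count suffices. Otherwise choose \<open>y\<close> and \<open>z\<close> on opposite sides without such
  neighbours. They are at distance at least 3, and if each neighbour of \<open>y\<close> is joined to \<open>z\<close> by a
  path of length 2, each of them has a neighbour across the cut. The required paths exist in
  the unit graph because the Chinese remainder theorem provides \<open>w\<close> with \<open>x + w\<close> and \<open>y + w\<close> both units, where \<open>x\<close> and \<open>y\<close> must
  have equal parity if \<open>n\<close> is even; only at the prime 2 can the two excluded classes exhaust
  all residues.\<close>

subsection \<open>Edge cuts\<close>

locale simple_graph =
  fixes V :: "'v set" and E :: "'v set set"
  assumes finite_V: "finite V"
    and edge: "e \<in> E \<Longrightarrow> \<exists>x\<in>V. \<exists>y\<in>V. x \<noteq> y \<and> e = {x, y}"
begin

lemma edgeE:
  assumes "e \<in> E"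
  obtains x y where "x \<in> V" "y \<in> V" "x \<noteq> y" "e = {x, y}"
  using edge[OF assms] by (elim bexE conjE)

definition nbrs :: "'v \<Rightarrow> 'v set" where
  "nbrs x = {y. {x, y} \<in> E}"

text \<open>Cut edges are oriented from \<open>S\<close> outwards, so each occurs once and the size
  is a sum over the vertices of \<open>S\<close>.\<close>

definition cut :: "'v set \<Rightarrow> ('v \<times> 'v) set" where
  "cut S = (SIGMA x : S. nbrs x - S)"

lemma edge_endpoints:
  assumes "{x, y} \<in> E"
  shows "x \<in> V" "y \<in> V" "x \<noteq> y"
  by (rule edgeE[OF assms]; auto simp: doubleton_eq_iff)+

lemma other_endpoint:
  assumes "e \<in> E" "x \<in> e"
  obtains y where "e = {x, y}" "x \<noteq> y"
  using assms(2) by (rule_tac edgeE[OF assms(1)]) auto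

lemma finite_E: "finite E"
proof (rule finite_subset)
  show "E \<subseteq> Pow V" by (auto elim: edgeE)
qed (simp add: finite_V)

lemma nbrs_subset: "nbrs x \<subseteq> V - {x}"
proof
  fix y assume "y \<in> nbrs x"
  then have "{x, y} \<in> E" by (simp add: nbrs_def)
  then show "y \<in> V - {x}"
    by (rule edgeE) (auto simp: doubleton_eq_iff)
qed

lemma finite_nbrs: "finite (nbrs x)"
  using nbrs_subset finite_V by (meson finite_Diff finite_subset)

lemma nbrs_sym: "y \<in> nbrs x \<longleftrightarrow> x \<in> nbrs y"
  by (simp add: nbrs_def insert_commute)

lemma card_incident_edges: "card {e \<in> E. x \<in> e} = card (nbrs x)"
proof -
  have "e \<in> (\<lambda>y. {x, y}) ` nbrs x" if e: "e \<in> E" "x \<in> e" for e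
    using e(1) by (rule_tac other_endpoint[OF e]) (auto simp: nbrs_def)
  then have "{e \<in> E. x \<in> e} = (\<lambda>y. {x, y}) ` nbrs x"
    by (auto simp: nbrs_def)
  moreover have "inj_on (\<lambda>y. {x, y}) (nbrs x)"
    by (auto intro!: inj_onI simp: doubleton_eq_iff)
  ultimately show ?thesis by (simp add: card_image)
qed

lemma handshake: "(\<Sum>x\<in>V. card (nbrs x)) = 2 * card E"
proof -
  have "(\<Sum>x\<in>V. card {e \<in> E. x \<in> e}) = 2 * card E"
  proof (rule sum_multicount[OF finite_V finite_E], safe)
    fix e assume "e \<in> E"
    then obtain x y where "x \<in> V" "y \<in> V" "x \<noteq> y" "e = {x, y}" using edgeE by metis
    then have "{v \<in> V. v \<in> e} = {x, y}" by auto
    with \<open>x \<noteq> y\<close> show "card {v \<in> V. v \<in> e} = 2" by simp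
  qed
  then show ?thesis by (simp add: card_incident_edges)
qed

lemma card_cut: "S \<subseteq> V \<Longrightarrow> card (cut S) = (\<Sum>x\<in>S. card (nbrs x - S))"
  unfolding cut_def using finite_V finite_nbrs by (auto intro!: card_SigmaI dest: finite_subset)

lemma finite_cut: "S \<subseteq> V \<Longrightarrow> finite (cut S)"
  unfolding cut_def using finite_V finite_nbrs by (auto intro!: finite_SigmaI dest: finite_subset)

lemma card_cut_Compl:
  assumes "S \<subseteq> V"
  shows "card (cut (V - S)) = card (cut S)"
proof -
  have "cut (V - S) = prod.swap ` cut S"
    using assms nbrs_sym nbrs_subset by (fastforce simp: cut_def image_iff)
  then show ?thesis by (simp add: card_image)
qed

text \<open>Neighbours of \<open>x\<close> outside \<open>S\<close> give cut edges at
  \<open>x\<close>; each neighbour inside \<open>S\<close> is charged to a cut edge starting at that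
  neighbour itself.\<close>

lemma cut_ge_degree:
  assumes S: "S \<subseteq> V" "x \<in> S" and cross: "\<And>y. y \<in> S \<Longrightarrow> nbrs y - S \<noteq> {}"
  shows "card (nbrs x) \<le> card (cut S)"
proof -
  have fin: "finite S" using S finite_V finite_subset by blast
  have "card (nbrs x) \<le> card ((nbrs x - S) \<union> (S - {x}))"
    using nbrs_subset fin finite_nbrs by (intro card_mono) auto
  also have "\<dots> \<le> card (nbrs x - S) + card (S - {x})" by (rule card_Un_le)
  also have "card (S - {x}) \<le> (\<Sum>y\<in>S - {x}. card (nbrs y - S))"
  proof -
    have "1 \<le> card (nbrs y - S)" if "y \<in> S - {x}" for y
      using cross[of y] that finite_nbrs by (simp add: Suc_le_eq card_gt_0_iff)
    then show ?thesis using sum_mono[of "S - {x}" "\<lambda>_. 1 :: nat"] by simp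
  qed
  also have "card (nbrs x - S) + (\<Sum>y\<in>S - {x}. card (nbrs y - S)) = card (cut S)"
    using S fin by (simp add: card_cut sum.remove)
  finally show ?thesis by simp
qed

text \<open>The hypothesis \<open>dist\<close> holds in graphs of diameter at most 2 and in bipartite graphs
  of diameter at most 3.\<close>

lemma min_degree_le_cut:
  assumes deg: "\<And>x. x \<in> V \<Longrightarrow> d \<le> card (nbrs x)"
    and dist: "\<And>x y. x \<in> V \<Longrightarrow> y \<in> V \<Longrightarrow> x \<noteq> y \<Longrightarrow>
      y \<in> nbrs x \<or> nbrs x \<inter> nbrs y \<noteq> {} \<or> (\<forall>w\<in>nbrs x. nbrs w \<inter> nbrs y \<noteq> {})"
    and S: "S \<subseteq> V" "S \<noteq> {}" "S \<noteq> V"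
  shows "d \<le> card (cut S)"
proof (cases "(\<forall>y\<in>S. nbrs y - S \<noteq> {}) \<or> (\<forall>y\<in>V - S. nbrs y - (V - S) \<noteq> {})")
  case True
  then show ?thesis
  proof
    assume "\<forall>y\<in>S. nbrs y - S \<noteq> {}"
    moreover obtain x where "x \<in> S" using S by blast
    ultimately show ?thesis using cut_ge_degree[of S x] deg[of x] S by fastforce
  next
    assume "\<forall>y\<in>V - S. nbrs y - (V - S) \<noteq> {}"
    moreover obtain x where "x \<in> V - S" using S by blast
    ultimately show ?thesis
      using cut_ge_degree[of "V - S" x] deg[of x] card_cut_Compl S by fastforce
  qed
next
  case False
  then obtain y z where y: "y \<in> S" "nbrs y \<subseteq> S" and z: "z \<in> V - S" "nbrs z \<subseteq> V - S" by blast
  then have "z \<notin> nbrs y" "nbrs y \<inter> nbrs z = {}" "y \<noteq> z" by auto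
  with dist[of y z] y z S have far: "\<forall>w\<in>nbrs y. nbrs w \<inter> nbrs z \<noteq> {}" by blast
  \<comment> \<open>Each neighbour \<open>w\<close> of \<open>y\<close> starts its own cut edge:
    \<open>w\<close> lies in \<open>S\<close> with all of \<open>nbrs y\<close>, and a common
    neighbour \<open>u\<close> of \<open>w\<close> and \<open>z\<close> lies outside with all of
    \<open>nbrs z\<close>.\<close>
  have "nbrs y \<subseteq> fst ` cut S"
  proof
    fix w assume "w \<in> nbrs y"
    with far obtain u where "u \<in> nbrs w" "u \<in> nbrs z" by blast
    with \<open>w \<in> nbrs y\<close> y z have "(w, u) \<in> cut S" by (auto simp: cut_def)
    then show "w \<in> fst ` cut S" by force
  qed
  then have "card (nbrs y) \<le> card (cut S)"
    using finite_cut[OF S(1)] by (rule surj_card_le[rotated])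
  with deg[of y] y S show ?thesis by force
qed

end

subsection \<open>Codes of signed incidence matrices\<close>

text \<open>One argument serves both cases through the choice of signs: constantly 1 where 1 = -1,
  and 1 or -1 according to the side of a bipartite graph.\<close>

locale signed_incidence = simple_graph V E for V :: "'v set" and E +
  fixes vs :: "'v list" and es :: "'v set list" and s :: "'v \<Rightarrow> 'a :: field"
  assumes vs: "distinct vs" "set vs = V"
    and es: "distinct es" "set es = E"
    and s_nonzero: "x \<in> V \<Longrightarrow> s x \<noteq> 0"
    and s_edge: "{x, y} \<in> E \<Longrightarrow> s x = - s y"
begin

definition H :: "int mat" where
  "H = mat (length vs) (length es) (\<lambda>(i, j). if vs ! i \<in> es ! j then 1 else 0)"

text \<open>Transposed, so that the row space of \<open>H\<close> is the range of \<open>M\<close>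
  on vectors of vertex coefficients.\<close>

definition M :: "'a mat" where "M = (map_mat of_int H)\<^sup>T"

text \<open>The signs \<open>s\<close> turn the coefficient sum over the endpoints of an edge into the
  difference of a vertex labelling.\<close>

definition vec_of :: "('v \<Rightarrow> 'a) \<Rightarrow> 'a vec" where
  "vec_of f = vec (length vs) (\<lambda>i. s (vs ! i) * f (vs ! i))"

lemma M_carrier: "M \<in> carrier_mat (length es) (length vs)"
  by (simp add: M_def H_def)

lemma vec_of_carrier: "vec_of f \<in> carrier_vec (length vs)"
  by (simp add: vec_of_def)

lemma vec_of_surj:
  assumes "a \<in> carrier_vec (length vs)"
  obtains f where "a = vec_of f"
proof
  define idx where "idx x = (THE i. i < length vs \<and> vs ! i = x)" for x
  have "idx (vs ! i) = i" if "i < length vs" for i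
    unfolding idx_def using that vs nth_eq_iff_index_eq by (intro the_equality) auto
  \<comment> \<open>Dividing by the nonzero sign undoes \<open>vec_of\<close>; \<open>idx\<close>
    inverts the enumeration \<open>vs\<close>.\<close>
  then show "a = vec_of (\<lambda>x. a $ idx x / s x)"
    using assms vs s_nonzero by (intro eq_vecI) (auto simp: vec_of_def)
qed

lemma M_vec_of:
  assumes j: "j < length es" and e: "es ! j = {x, y}"
  shows "(M *\<^sub>v vec_of f) $ j = s x * (f x - f y)"
proof -
  have E: "{x, y} \<in> E" using j e es by (metis nth_mem)
  note xy = edge_endpoints[OF E]
  have "(M *\<^sub>v vec_of f) $ j = (\<Sum>i<length vs. if vs ! i \<in> {x, y} then s (vs ! i) * f (vs ! i) else 0)"
    using j by (auto simp: M_def H_def vec_of_def scalar_prod_def e lessThan_atLeast0 intro!: sum.cong)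
  also have "\<dots> = (\<Sum>v\<in>V. if v \<in> {x, y} then s v * f v else 0)"
    by (rule sum.reindex_bij_betw[OF bij_betw_nth[OF vs(1)]]) (auto simp: vs)
  also have "\<dots> = (\<Sum>v\<in>{x, y}. s v * f v)"
    using finite_V xy by (intro sum.mono_neutral_cong_right) auto
  also have "\<dots> = s x * (f x - f y)"
    using xy s_edge[of y x] E by (simp add: insert_commute algebra_simps)
  finally show ?thesis .
qed

lemma row_code_eq: "row_code H = {M *\<^sub>v vec_of f | f. True}"
proof -
  interpret vec_space "TYPE('a)" "length es" .
  have "row_code H = {w \<in> carrier_vec (length es). \<exists>y\<in>carrier_vec (length vs). M *\<^sub>v y = w}"
    unfolding row_code_def M_def using row_space_eq[of "map_mat of_int H" "length vs"]
    by (simp add: H_def)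
  also have "\<dots> = {M *\<^sub>v vec_of f | f. True}"
    using vec_of_surj vec_of_carrier M_carrier by (auto 4 3 intro: mult_mat_vec_carrier)
  finally show ?thesis .
qed

lemma hamming_weight_eq:
  "hamming_weight (M *\<^sub>v vec_of f) = card {e \<in> E. \<exists>x y. e = {x, y} \<and> f x \<noteq> f y}"
proof -
  have "bij_betw ((!) es) {j. j < length es \<and> (M *\<^sub>v vec_of f) $ j \<noteq> 0}
     {e \<in> E. \<exists>x y. e = {x, y} \<and> f x \<noteq> f y}"
  proof (rule bij_betw_imageI)
    show "inj_on ((!) es) {j. j < length es \<and> (M *\<^sub>v vec_of f) $ j \<noteq> 0}"
      using es by (auto intro!: inj_onI simp: nth_eq_iff_index_eq)
    have *: "(M *\<^sub>v vec_of f) $ j \<noteq> 0 \<longleftrightarrow> (\<exists>x y. es ! j = {x, y} \<and> f x \<noteq> f y)"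
      if j: "j < length es" for j
    proof -
      have "es ! j \<in> E" using es j by auto
      then obtain x y where xy: "x \<in> V" "es ! j = {x, y}" by (rule edgeE)
      then show ?thesis using M_vec_of[OF j xy(2), of f] s_nonzero[OF xy(1)]
        by (auto simp: doubleton_eq_iff)
    qed
    show "(!) es ` {j. j < length es \<and> (M *\<^sub>v vec_of f) $ j \<noteq> 0} =
      {e \<in> E. \<exists>x y. e = {x, y} \<and> f x \<noteq> f y}"
    proof (intro equalityI subsetI)
      fix e assume e: "e \<in> {e \<in> E. \<exists>x y. e = {x, y} \<and> f x \<noteq> f y}"
      then obtain j where "j < length es" "es ! j = e" using es
        by (metis (lifting) in_set_conv_nth mem_Collect_eq)
      with e * show "e \<in> (!) es ` {j. j < length es \<and> (M *\<^sub>v vec_of f) $ j \<noteq> 0}"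
        by blast
    qed (use * es in auto)
  qed
  moreover have "dim_vec (M *\<^sub>v vec_of f) = length es" using M_carrier by auto
  ultimately show ?thesis unfolding hamming_weight_def by (auto dest: bij_betw_same_card)
qed

text \<open>An edge leaving the level set of \<open>f u\<close> changes label, so it lies in the
  support. Exactly one of its ends is in the level set, so the edge determines its oriented
  pair.\<close>

lemma card_cut_le_weight:
  assumes "u \<in> V"
  shows "card (cut {x \<in> V. f x = f u}) \<le> hamming_weight (M *\<^sub>v vec_of f)"
  unfolding hamming_weight_eq
proof (rule card_inj_on_le)
  let ?C = "cut {x \<in> V. f x = f u}"
  show "inj_on (\<lambda>(x, y). {x, y}) ?C"
    by (auto intro!: inj_onI simp: cut_def doubleton_eq_iff)
  show "(\<lambda>(x, y). {x, y}) ` ?C \<subseteq> {e \<in> E. \<exists>x y. e = {x, y} \<and> f x \<noteq> f y}"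
    using nbrs_subset by (fastforce simp: cut_def nbrs_def)
qed (simp add: finite_E)

lemma M_vec_of_const: "M *\<^sub>v vec_of (\<lambda>_. c) = 0\<^sub>v (length es)"
proof (rule eq_vecI)
  fix j assume "j < dim_vec (0\<^sub>v (length es) :: 'a vec)"
  then have j: "j < length es" by simp
  then have "es ! j \<in> E" using es by auto
  then obtain x y where "es ! j = {x, y}" by (rule edgeE)
  from M_vec_of[OF j this] j show "(M *\<^sub>v vec_of (\<lambda>_. c)) $ j = 0\<^sub>v (length es) $ j" by simp
qed (use M_carrier in simp)

lemma hamming_weight_zero: "hamming_weight (0\<^sub>v k :: 'a vec) = 0"
  by (simp add: hamming_weight_def)

text \<open>Since \<open>d\<close> is positive, the cut hypothesis includes connectedness and so
  determines the kernel. Applied to the level set of \<open>f x0\<close>, it also bounds every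
  nonzero weight, and the vertex \<open>x0\<close> attains the bound.\<close>

lemma linear_code_row_code:
  assumes cut: "\<And>S. S \<subseteq> V \<Longrightarrow> S \<noteq> {} \<Longrightarrow> S \<noteq> V \<Longrightarrow> d \<le> card (cut S)"
    and x0: "x0 \<in> V" "card (nbrs x0) = d" and d: "0 < d"
  shows "linear_code (row_code H :: 'a vec set) (card E) (card V - 1) d"
proof -
  have len: "length vs = card V" "length es = card E"
    using vs es distinct_card by metis+
  interpret D: vec_space "TYPE('a)" "length vs" .
  interpret W: vec_space "TYPE('a)" "length es" .
  interpret T: linear_map class_ring "module_vec TYPE('a) (length vs)"
      "module_vec TYPE('a) (length es)" "\<lambda>a. M *\<^sub>v a"
  proof
    show "(\<lambda>a. M *\<^sub>v a) \<in> LinearCombinations.module_hom class_ring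
        (module_vec TYPE('a) (length vs)) (module_vec TYPE('a) (length es))"
      using M_carrier
      by (auto simp: LinearCombinations.module_hom_def module_vec_simps
        mult_add_distrib_mat_vec mult_mat_vec)
  qed
  have im: "T.im = row_code H"
    unfolding T.im_def row_code_eq using vec_of_carrier
    by (auto simp: module_vec_simps elim: vec_of_surj)
  have zero_iff: "M *\<^sub>v vec_of f = 0\<^sub>v (length es) \<longleftrightarrow> (\<exists>c. vec_of f = vec_of (\<lambda>_. c))" for f
  proof
    assume 0: "M *\<^sub>v vec_of f = 0\<^sub>v (length es)"
    have "{x \<in> V. f x = f x0} = V"
    proof (rule ccontr)
      assume "{x \<in> V. f x = f x0} \<noteq> V"
      then have "d \<le> card (local.cut {x \<in> V. f x = f x0})"
        using x0 by (intro cut) auto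
      also have "\<dots> \<le> 0" using card_cut_le_weight[OF x0(1), of f] 0 hamming_weight_zero by simp
      finally show False using d by simp
    qed
    then have "vec_of f = vec_of (\<lambda>_. f x0)"
      using vs nth_mem by (intro eq_vecI) (fastforce simp: vec_of_def)+
    then show "\<exists>c. vec_of f = vec_of (\<lambda>_. c)" ..
  qed (auto simp: M_vec_of_const)
  have min: "d \<le> hamming_weight (M *\<^sub>v vec_of f)" if "M *\<^sub>v vec_of f \<noteq> 0\<^sub>v (length es)" for f
  proof -
    have "{x \<in> V. f x = f x0} \<noteq> V"
    proof
      assume "{x \<in> V. f x = f x0} = V"
      then have "vec_of f = vec_of (\<lambda>_. f x0)"
        using vs nth_mem by (intro eq_vecI) (fastforce simp: vec_of_def)+
      then show False using that zero_iff by blast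
    qed
    then have "d \<le> card (local.cut {x \<in> V. f x = f x0})" using x0 by (intro cut) auto
    also have "\<dots> \<le> hamming_weight (M *\<^sub>v vec_of f)" by (rule card_cut_le_weight[OF x0(1)])
    finally show ?thesis .
  qed
  \<comment> \<open>Up to the factor \<open>s x0\<close> this codeword is the row of
    \<open>x0\<close>, supported on the edges at \<open>x0\<close>.\<close>
  have attained: "hamming_weight (M *\<^sub>v vec_of (\<lambda>x. of_bool (x = x0))) = d"
  proof -
    have "(\<exists>x y. e = {x, y} \<and> of_bool (x = x0) \<noteq> (of_bool (y = x0) :: 'a)) \<longleftrightarrow> x0 \<in> e"
      if e: "e \<in> E" for e
    proof -
      obtain x y where "x \<noteq> y" "e = {x, y}" using e by (rule edgeE)
      then show ?thesis by (auto simp: doubleton_eq_iff)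
    qed
    then have "{e \<in> E. \<exists>x y. e = {x, y} \<and> of_bool (x = x0) \<noteq> (of_bool (y = x0) :: 'a)} =
        {e \<in> E. x0 \<in> e}"
      by blast
    then show ?thesis by (simp add: hamming_weight_eq card_incident_edges x0)
  qed
  \<comment> \<open>The constant labelling 1 yields the vector of signs \<open>s\<close>, which
    spans the kernel.\<close>
  define ones where "ones = vec_of (\<lambda>_. 1)"
  have smult_vec_of: "vec_of (\<lambda>_. c) = c \<cdot>\<^sub>v ones" for c
    by (auto simp: vec_of_def ones_def)
  have ker: "T.ker = {c \<cdot>\<^sub>v ones | c. True}"
  proof (intro equalityI subsetI)
    fix a assume "a \<in> T.ker"
    then have a: "a \<in> carrier_vec (length vs)" "M *\<^sub>v a = 0\<^sub>v (length es)"
      by (auto simp: T.ker_def module_vec_simps)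
    from vec_of_surj[OF a(1)] obtain f where "a = vec_of f" .
    with a zero_iff obtain c where "a = vec_of (\<lambda>_. c)" by metis
    then have "a = c \<cdot>\<^sub>v ones" using smult_vec_of by metis
    then show "a \<in> {c \<cdot>\<^sub>v ones | c. True}" by blast
  next
    fix a assume "a \<in> {c \<cdot>\<^sub>v ones | c. True}"
    then obtain c where "a = c \<cdot>\<^sub>v ones" by blast
    then have "a = vec_of (\<lambda>_. c)" by (rule trans[OF _ smult_vec_of[symmetric]])
    then show "a \<in> T.ker" using M_vec_of_const vec_of_carrier
      by (auto simp: T.ker_def module_vec_simps)
  qed
  interpret K: vectorspace class_ring "D.vs T.ker"
    by (rule D.subspace_is_vs[OF T.kerT_is_subspace])
  have one_ker: "ones \<in> T.ker"
    using M_vec_of_const vec_of_carrier by (auto simp: ones_def T.ker_def module_vec_simps)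
  have "K.dim = 1"
  proof (rule K.dim1I)
    show "ones \<in> carrier (D.vs T.ker)" using one_ker by simp
    have "ones \<noteq> 0\<^sub>v (length vs)"
    proof
      assume 0: "ones = 0\<^sub>v (length vs)"
      obtain i where "i < length vs" "vs ! i = x0" using x0 vs by (metis in_set_conv_nth)
      with arg_cong[OF 0, of "\<lambda>v. v $ i"] s_nonzero[OF x0(1)] show False
        by (simp add: vec_of_def ones_def)
    qed
    then show "ones \<noteq> \<zero>\<^bsub>D.vs T.ker\<^esub>" by (simp add: module_vec_simps)
    show "K.gen_set {ones}"
    proof (subst D.span_li_not_depend(1))
      show "{ones} \<subseteq> T.ker" using one_ker by simp
      show "submodule class_ring T.ker (module_vec TYPE('a) (length vs))"
        by (rule T.ker_is_submodule)
      show "D.span {ones} = carrier (D.vs T.ker)"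
      proof -
        have v: "ones \<in> carrier_vec (length vs)" unfolding ones_def by (rule vec_of_carrier)
        have lincomb: "D.lincomb a {ones} = a ones \<cdot>\<^sub>v ones" for a
          using D.lincomb_insert2[where S = "{}" and v = ones and a = a] v by simp
        have "D.span {ones} = {D.lincomb a {ones} | a. True}"
          using D.finite_span[of "{ones}"] v by simp
        moreover have "\<exists>a. c = (a ones :: 'a)" for c
          by (rule exI[of _ "\<lambda>_. c"]) simp
        then have "{D.lincomb a {ones} | a. True} = {c \<cdot>\<^sub>v ones | c. True}"
          unfolding lincomb by (intro Collect_cong) metis
        ultimately show ?thesis by (simp add: ker)
      qed
    qed
  qed
  \<comment> \<open>The kernel is a line, so rank-nullity on a space of dimension
    \<open>card V\<close> loses exactly 1.\<close>
  moreover have "vectorspace.dim class_ring (W.vs T.im) + K.dim = D.dim"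
    by (rule T.rank_nullity) simp
  ultimately have "vectorspace.dim class_ring (W.vs (row_code H :: 'a vec set)) = card V - 1"
    using D.dim_is_n len(1) unfolding im by simp
  moreover have "VectorSpace.subspace class_ring (row_code H :: 'a vec set) (module_vec TYPE('a) (length es))"
    using T.imT_is_subspace im by simp
  moreover have "M *\<^sub>v vec_of (\<lambda>x. of_bool (x = x0)) \<noteq> 0\<^sub>v (length es)"
    using attained d hamming_weight_zero by (metis less_numeral_extra(3))
  ultimately show ?thesis
    unfolding linear_code_def using min attained row_code_eq len by (auto intro!: bexI)
qed

end

subsection \<open>Unit graphs of residue rings\<close>

lemma coprime_int_iff_prime_factors:
  fixes a :: int and n :: nat
  assumes "n > 0"
  shows "coprime a (int n) \<longleftrightarrow> (\<forall>p\<in>prime_factors n. \<not> int p dvd a)"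
proof
  assume "coprime a (int n)"
  then show "\<forall>p\<in>prime_factors n. \<not> int p dvd a"
    by (metis coprime_common_divisor in_prime_factors_iff int_dvd_int_iff not_prime_unit
        prime_nat_int_transfer)
next
  assume *: "\<forall>p\<in>prime_factors n. \<not> int p dvd a"
  show "coprime a (int n)"
  proof (rule ccontr)
    assume "\<not> coprime a (int n)"
    then have "nat (gcd a (int n)) \<noteq> 1" by (simp add: coprime_iff_gcd_eq_1 nat_eq_iff)
    then obtain p where p: "prime p" "p dvd nat (gcd a (int n))" using prime_factor_nat by blast
    then have "int p dvd gcd a (int n)"
      by (metis gcd_ge_0_int int_dvd_int_iff int_nat_eq)
    then have "int p dvd a" "p dvd n" by auto
    with * p assms show False by (auto simp: in_prime_factors_iff)
  qed
qed

lemma exists_common_coprime_shift: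
  fixes x y :: int and n :: nat
  assumes "n > 0" and parity: "even n \<Longrightarrow> even (x - y)"
  shows "\<exists>z. coprime (x + z) (int n) \<and> coprime (y + z) (int n)"
proof -
  have "\<exists>t. \<not> int p dvd x + t \<and> \<not> int p dvd y + t" if p: "p \<in> prime_factors n" for p
  \<comment> \<open>Try \<open>t = 1 - x\<close>, then \<open>t = 2 - x\<close>:
    \<open>x + t\<close> becomes 1 or 2, and \<open>y + t\<close> takes two consecutive values,
    which \<open>p\<close> cannot both divide. The value 2 is bad only for \<open>p = 2\<close>, but
    then equal parity makes \<open>y - x + 1\<close> odd and the first choice works.\<close>
  proof (cases "int p dvd y - x + 1")
    case False
    then show ?thesis using p by (intro exI[of _ "1 - x"]) (auto simp: algebra_simps)
  next
    case True
    have "\<not> int p dvd y - x + 2"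
    proof
      assume "int p dvd y - x + 2"
      then have "int p dvd (y - x + 2) - (y - x + 1)" using True dvd_diff by blast
      then show False using prime_gt_1_nat[of p] p by (auto simp: in_prime_factors_iff)
    qed
    moreover have "\<not> int p dvd 2"
    proof
      assume "int p dvd 2"
      then have "p dvd 2" using int_dvd_int_iff[of p 2] by simp
      then have "p = 2" using p primes_dvd_imp_eq two_is_prime_nat by blast
      then have "even (x - y)" "even (y - x + 1)" using parity p True by auto
      then show False by presburger
    qed
    ultimately show ?thesis by (intro exI[of _ "2 - x"]) (auto simp: algebra_simps)
  qed
  then obtain t where t: "\<And>p. p \<in> prime_factors n \<Longrightarrow> \<not> int p dvd x + t p \<and> \<not> int p dvd y + t p"
    by metis
  \<comment> \<open>The congruences are solved over the naturals, hence the nonnegative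
    representatives of \<open>t p\<close>.\<close>
  have "\<exists>z. \<forall>p\<in>prime_factors n. [z = nat (t p mod int p)] (mod p)"
    by (rule chinese_remainder_nat) (auto intro!: primes_coprime)
  then obtain z where z: "\<And>p. p \<in> prime_factors n \<Longrightarrow> [z = nat (t p mod int p)] (mod p)"
    by blast
  have "[int z = t p] (mod int p)" if p: "p \<in> prime_factors n" for p
  proof -
    have "p > 0" using p prime_gt_0_nat by auto
    then have "[int z = t p mod int p] (mod int p)"
      using z[OF p, folded cong_int_iff] by simp
    then show ?thesis by (simp add: cong_def)
  qed
  then have "int p dvd a + int z \<longleftrightarrow> int p dvd a + t p" if "p \<in> prime_factors n" for p a
    using that cong_dvd_iff cong_add cong_refl by metis
  with t assms(1) show ?thesis
    by (intro exI[of _ "int z"]) (simp add: coprime_int_iff_prime_factors)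
qed

locale residue_unit_graph =
  fixes n :: nat
  assumes n_gt_1: "n > 1"
begin

definition V :: "int set" where "V = {0..<int n}"

text \<open>The sum stays an unreduced integer; \<open>units_iff\<close> accounts for the reduction
  modulo \<open>n\<close> in the ring sum.\<close>

definition E :: "int set set" where
  "E = {{x, y} | x y. x \<in> V \<and> y \<in> V \<and> x \<noteq> y \<and> coprime (x + y) (int n)}"

sublocale residues "int n" "residue_ring (int n)"
  using n_gt_1 by unfold_locales auto

lemma units_iff: "a mod int n \<in> Units (residue_ring (int n)) \<longleftrightarrow> coprime a (int n)"
proof
  assume "a mod int n \<in> Units (residue_ring (int n))"
  then show "coprime a (int n)" using n_gt_1 by (simp add: res_units_eq)
qed (use n_gt_1 in simp)

lemma unit_graph_eq: "unit_graph (residue_ring (int n)) = (V, E)"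
proof -
  have "carrier (residue_ring (int n)) = V" by (auto simp: res_carrier_eq V_def)
  then show ?thesis by (simp add: unit_graph_def E_def res_add_eq units_iff)
qed

sublocale simple_graph V E
proof
  fix e assume "e \<in> E"
  then obtain x y where "x \<in> V" "y \<in> V" "x \<noteq> y" "e = {x, y}" unfolding E_def by blast
  then show "\<exists>x\<in>V. \<exists>y\<in>V. x \<noteq> y \<and> e = {x, y}" by blast
qed (simp add: V_def)

lemma edge_iff: "{x, y} \<in> E \<longleftrightarrow> x \<in> V \<and> y \<in> V \<and> x \<noteq> y \<and> coprime (x + y) (int n)"
proof
  assume "{x, y} \<in> E"
  then obtain a b where "{x, y} = {a, b}" "a \<in> V" "b \<in> V" "a \<noteq> b" "coprime (a + b) (int n)"
    unfolding E_def by blast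
  then show "x \<in> V \<and> y \<in> V \<and> x \<noteq> y \<and> coprime (x + y) (int n)"
    by (auto simp: doubleton_eq_iff add.commute)
qed (unfold E_def, blast)

lemma nbrs_iff: "y \<in> nbrs x \<longleftrightarrow> x \<in> V \<and> y \<in> V \<and> x \<noteq> y \<and> coprime (x + y) (int n)"
  by (simp add: nbrs_def edge_iff)

section \<open>Degrees and numbers of edges\<close>

lemma card_V: "card V = n"
  by (simp add: V_def)

text \<open>Translation by \<open>x\<close> modulo \<open>n\<close> permutes the residues and
  carries this set onto the units.\<close>

lemma card_coprime_shift: "card {y \<in> V. coprime (x + y) (int n)} = totient n"
proof -
  have "bij_betw (\<lambda>y. (x + y) mod int n) {y \<in> V. coprime (x + y) (int n)} (Units (residue_ring (int n)))"
  proof (rule bij_betwI[where g = "\<lambda>u. (u - x) mod int n"])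
    show "(\<lambda>u. (u - x) mod int n) \<in> Units (residue_ring (int n)) \<rightarrow> {y \<in> V. coprime (x + y) (int n)}"
    proof
      fix u assume u: "u \<in> Units (residue_ring (int n))"
      have "(x + (u - x) mod int n) mod int n = u mod int n" by (simp add: mod_simps)
      also have "\<dots> = u" using u by (simp add: res_units_eq)
      finally have "coprime (x + (u - x) mod int n) (int n)" using u units_iff by metis
      then show "(u - x) mod int n \<in> {y \<in> V. coprime (x + y) (int n)}"
        using n_gt_1 by (simp add: V_def)
    qed
    show "(\<lambda>y. (x + y) mod int n) \<in> {y \<in> V. coprime (x + y) (int n)} \<rightarrow> Units (residue_ring (int n))"
      by (simp add: units_iff)
  qed (auto simp: V_def mod_simps res_units_eq)
  then show ?thesis using totient_eq by (metis bij_betw_same_card nat_int)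
qed

text \<open>The shifted units count \<open>y = x\<close> when \<open>2 * x\<close> is a unit,
  whereas a simple graph has no loop there.\<close>

lemma degree:
  assumes "x \<in> V"
  shows "card (nbrs x) + of_bool (coprime (2 * x) (int n)) = totient n"
proof -
  have "{y \<in> V. coprime (x + y) (int n)} =
      (if coprime (2 * x) (int n) then insert x (nbrs x) else nbrs x)"
    using assms by (auto simp: nbrs_iff)
  moreover have "x \<notin> nbrs x" by (simp add: nbrs_iff)
  ultimately show ?thesis using card_coprime_shift[of x] finite_nbrs[of x]
    by (simp split: if_splits)
qed

text \<open>As 2 is invertible, \<open>2 * x\<close> is a unit exactly when \<open>x\<close> is. So
  \<open>totient n\<close> vertices lose one neighbour in the handshake sum.\<close>

lemma card_E_odd:
  assumes "odd n"
  shows "card E = (n - 1) * totient n div 2"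
proof -
  have "(\<Sum>x\<in>V. card (nbrs x) + of_bool (coprime (2 * x) (int n))) = n * totient n"
    using degree by (simp add: card_V)
  moreover have "(\<Sum>x\<in>V. of_bool (coprime (2 * x) (int n))) = totient n"
  proof -
    have "(\<Sum>x\<in>V. of_bool (coprime (2 * x) (int n))) = card {x \<in> V. coprime x (int n)}"
      using assms finite_V by (simp add: Int_def flip: sum.inter_filter)
    then show ?thesis using card_coprime_shift[of 0] by simp
  qed
  ultimately have "2 * card E + totient n = n * totient n"
    by (simp add: sum.distrib handshake)
  then have "2 * card E = (n - 1) * totient n" by (simp add: diff_mult_distrib)
  then show ?thesis by simp
qed

text \<open>No \<open>2 * x\<close> is a unit, so the graph is regular of degree
  \<open>totient n\<close>.\<close>

lemma card_E_even:
  assumes "even n"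
  shows "card E = n * totient n div 2"
proof -
  have "(\<Sum>x\<in>V. card (nbrs x)) = (\<Sum>x\<in>V. totient n)"
    using degree assms by (intro sum.cong) (fastforce simp: coprime_mult_left_iff)+
  then show ?thesis by (simp add: handshake card_V)
qed

section \<open>Parity and short paths\<close>

lemma odd_of_coprime:
  assumes "even n" "coprime a (int n)"
  shows "odd a"
proof
  assume "even a"
  then have "2 dvd gcd a (int n)" using assms(1) by simp
  then show False using assms(2) unfolding coprime_iff_gcd_eq_1 by (metis odd_one)
qed

lemma adjacent_or_common_nbr:
  assumes "x \<in> V" "y \<in> V" "x \<noteq> y" and "even n \<Longrightarrow> even (x - y)"
  shows "y \<in> nbrs x \<or> nbrs x \<inter> nbrs y \<noteq> {}"
proof -
  obtain z where z: "coprime (x + z) (int n)" "coprime (y + z) (int n)"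
    using exists_common_coprime_shift[of n x y] assms n_gt_1 by auto
  define w where "w = z mod int n"
  have "coprime (a + w) (int n) \<longleftrightarrow> coprime (a + z) (int n)" for a
    unfolding w_def by (metis mod_add_right_eq units_iff)
  with z have w: "coprime (x + w) (int n)" "coprime (y + w) (int n)" by auto
  have "w \<in> V" using n_gt_1 by (simp add: w_def V_def)
  \<comment> \<open>If \<open>w\<close> coincides with \<open>x\<close> or \<open>y\<close> it is no
    midpoint of a path, but then \<open>x + y\<close> itself is a unit.\<close>
  show ?thesis
  proof (cases "w = x \<or> w = y")
    case True
    then have "coprime (x + y) (int n)" using w by (auto simp: add.commute)
    then show ?thesis using assms by (simp add: nbrs_iff)
  next
    case False
    then have "w \<in> nbrs x \<inter> nbrs y" using w assms \<open>w \<in> V\<close> by (auto simp: nbrs_iff)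
    then show ?thesis by blast
  qed
qed

text \<open>This supplies \<open>dist\<close> in \<open>min_degree_le_cut\<close>. Beyond
  \<open>adjacent_or_common_nbr\<close> there remain opposite parities with \<open>n\<close> even: a
  neighbour \<open>w\<close> of \<open>x\<close> then has the parity of \<open>y\<close>, so
  \<open>w + y\<close> is no unit and \<open>w\<close>, \<open>y\<close> must have a common
  neighbour.\<close>

lemma near_vertices:
  assumes "x \<in> V" "y \<in> V" "x \<noteq> y"
  shows "y \<in> nbrs x \<or> nbrs x \<inter> nbrs y \<noteq> {} \<or> (\<forall>w\<in>nbrs x. nbrs w \<inter> nbrs y \<noteq> {})"
proof (cases "even n \<and> odd (x - y)")
  case False
  then show ?thesis using adjacent_or_common_nbr assms by blast
next
  case True
  have "nbrs w \<inter> nbrs y \<noteq> {}" if "y \<notin> nbrs x" and w: "w \<in> nbrs x" for w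
  proof -
    have "odd (x + w)" using True w odd_of_coprime by (auto simp: nbrs_iff)
    then have "even (w - y)" "even (w + y)" using True by auto
    moreover have "w \<in> V" "w \<noteq> y" using that by (auto simp: nbrs_iff)
    ultimately show ?thesis
      using adjacent_or_common_nbr[of w y] assms True odd_of_coprime by (auto simp: nbrs_iff)
  qed
  then show ?thesis by blast
qed

end

lemma one_eq_minus_one_mod_ring:
  assumes "CARD('b :: prime_card) = 2"
  shows "(1 :: 'b mod_ring) = - 1"
proof -
  have "(1 :: 'b mod_ring) + 1 = 0" using assms by transfer simp
  then show ?thesis by (simp add: eq_neg_iff_add_eq_0)
qed

section \<open>Code parameters for odd and even n\<close>

context residue_unit_graph
begin

lemma linear_code_row_code_odd:
  fixes s :: "int \<Rightarrow> 'a :: field"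
  assumes "signed_incidence V E vs es s" and "odd n"
    and H: "H = mat (length vs) (length es) (\<lambda>(i, j). if vs ! i \<in> es ! j then 1 else 0)"
  shows "linear_code (row_code H :: 'a vec set) ((n - 1) * totient n div 2) (n - 1) (totient n - 1)"
proof -
  interpret S: signed_incidence V E vs es s by fact
  \<comment> \<open>Oddness excludes \<open>n = 2\<close>, where \<open>totient n - 1\<close> would
    vanish.\<close>
  have "n > 2" using n_gt_1 \<open>odd n\<close> by presburger
  then have pos: "0 < totient n - 1" using totient_gt_1 by simp
  \<comment> \<open>The vertex 1 has minimum degree, because \<open>2 * 1\<close> is a unit for odd
    \<open>n\<close>.\<close>
  have "1 \<in> V" using n_gt_1 by (simp add: V_def)
  moreover have "card (nbrs 1) = totient n - 1"
    using degree[of 1] \<open>1 \<in> V\<close> \<open>odd n\<close> by simp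
  moreover have "totient n - 1 \<le> card (nbrs x)" if "x \<in> V" for x
    using degree[OF that] by (auto simp: of_bool_def split: if_splits)
  ultimately have "linear_code (row_code S.H :: 'a vec set) (card E) (card V - 1) (totient n - 1)"
    using pos near_vertices by (intro S.linear_code_row_code[of _ 1] min_degree_le_cut) auto
  then show ?thesis using card_V card_E_odd \<open>odd n\<close> by (simp add: S.H_def H)
qed

lemma linear_code_row_code_even:
  fixes s :: "int \<Rightarrow> 'a :: field"
  assumes "signed_incidence V E vs es s" and "even n"
    and H: "H = mat (length vs) (length es) (\<lambda>(i, j). if vs ! i \<in> es ! j then 1 else 0)"
  shows "linear_code (row_code H :: 'a vec set) (n * totient n div 2) (n - 1) (totient n)"
proof -
  interpret S: signed_incidence V E vs es s by fact
  have deg: "card (nbrs x) = totient n" if "x \<in> V" for x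
    using degree[OF that] \<open>even n\<close> by simp
  moreover have "0 \<in> V" using n_gt_1 by (simp add: V_def)
  ultimately have "linear_code (row_code S.H :: 'a vec set) (card E) (card V - 1) (totient n)"
    using n_gt_1 near_vertices by (intro S.linear_code_row_code[of _ 0] min_degree_le_cut) auto
  then show ?thesis using card_V card_E_even \<open>even n\<close> by (simp add: S.H_def H)
qed

end

theorem theorem5p7:
  fixes n p1 p2 p3 n1 n2 n3 :: nat and H :: "int mat"
  assumes "prime p1" "prime p2" "prime p3"
    and "p1 \<noteq> p2" "p1 \<noteq> p3" "p2 \<noteq> p3"
    and "n1 \<ge> 1" "n2 \<ge> 1" "n3 \<ge> 1"
    and "n = p1 ^ n1 * p2 ^ n2 * p3 ^ n3"
    and "incidence_matrix (unit_graph (residue_ring (int n))) H"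
  shows "(2 \<in> Units (residue_ring (int n)) \<longrightarrow> CARD('b :: prime_card) = 2 \<longrightarrow>
      linear_code (row_code H :: 'b mod_ring vec set)
        ((n - 1) * totient n div 2) (n - 1) (totient n - 1)) \<and>
    (2 \<notin> Units (residue_ring (int n)) \<longrightarrow> odd CARD('q :: prime_card) \<longrightarrow>
      linear_code (row_code H :: 'q mod_ring vec set)
        (n * totient n div 2) (n - 1) (totient n))"
proof -
  \<comment> \<open>The resulting \<open>n > 2\<close> ensures that 2 is its own residue, as
    \<open>two\<close> requires.\<close>
  have "2 * 2 \<le> p1 ^ n1 * p2 ^ n2"
    using assms by (intro mult_mono)
      (auto intro: order_trans[OF prime_ge_2_nat self_le_power] simp: prime_gt_0_nat Suc_le_eq)
  moreover have "1 \<le> p3 ^ n3" using assms prime_gt_0_nat by (simp add: Suc_le_eq)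
  ultimately have "2 * 2 * 1 \<le> n" unfolding assms(10) by (rule mult_mono) auto
  then have n: "n > 2" by simp
  then interpret residue_unit_graph n by unfold_locales simp
  from assms(11) obtain vs es where vs: "distinct vs" "set vs = V"
    and es: "distinct es" "set es = E"
    and H: "H = mat (length vs) (length es) (\<lambda>(i, j). if vs ! i \<in> es ! j then 1 else 0)"
    by (auto simp: incidence_matrix_def unit_graph_eq)
  have two: "2 \<in> Units (residue_ring (int n)) \<longleftrightarrow> odd n"
    using n units_iff[of 2] by simp
  show ?thesis
  proof (intro conjI impI)
    assume "2 \<in> Units (residue_ring (int n))" and "CARD('b) = 2"
    then have "signed_incidence V E vs es (\<lambda>_. 1 :: 'b mod_ring)"
      using vs es one_eq_minus_one_mod_ring by unfold_locales auto
    then show "linear_code (row_code H :: 'b mod_ring vec set)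
        ((n - 1) * totient n div 2) (n - 1) (totient n - 1)"
      using H two \<open>2 \<in> Units (residue_ring (int n))\<close> by (intro linear_code_row_code_odd) auto
  next
    assume "2 \<notin> Units (residue_ring (int n))"
    then have "even n" using two by blast
    \<comment> \<open>For even \<open>n\<close> the ends of an edge have odd sum, so parity is a
      bipartition and gives the signs.\<close>
    have "signed_incidence V E vs es (\<lambda>x. if even x then 1 else - 1 :: 'q mod_ring)"
    proof
      fix x y assume "{x, y} \<in> E"
      then have "odd (x + y)" using odd_of_coprime[OF \<open>even n\<close>, of "x + y"] by (simp add: edge_iff)
      then show "(if even x then 1 else - 1 :: 'q mod_ring) = - (if even y then 1 else - 1)" by auto
    qed (use vs es in auto)
    then show "linear_code (row_code H :: 'q mod_ring vec set) (n * totient n div 2) (n - 1) (totient n)"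
      using H \<open>even n\<close> by (intro linear_code_row_code_even)
  qed
qed

end
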